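(* For each $n$ consider the random intersection graph with communities $\mathrm{RIGC}(\boldsymbol d^{l},\mathbf{Com})$, under conditions (A)–(D) of the context. Let $$\zeta\overset d=\Big(\sum_{i=1}^{D^l}\Lambda^{c}_{(i)}\Big)\Big/\binom{\sum_{i=1}^{D^l}D^{c}_{(i)}}{2},$$ where $(D^c_{(i)},\Lambda^c_{(i)})_{i\ge1}$ are i.i.d. copies of the random vector $(D^c,\Lambda^c)$, independent of $D^l$, and $\zeta:=0$ when $\sum_{i=1}^{D^l}D^c_{(i)}<2$. Then the asymptotic average clustering $\mathbb E[\zeta]$ is positive if and only if $\mathbb P(\Lambda^{c}\ge1)>0$.
   Context: **Parameters.** For each $n$: individuals $[N_n]$ and communities $[M_n]$, with $N_n,M_n\to\infty$. Each individual $v$ has a number of memberships $d^{l}_v\ge 1$. Let $\mathscr H$ be the set of non-empty, simple, finite, connected graphs, one representative per isomorphism class, with $H\in\mathscr H$ having vertex set $[|H|]$. Each community $a$ has a community graph $\mathrm{Com}_a\in\mathscr H$, and $d^{r}_a=|\mathrm{Com}_a|\ge1$. Assume $h_n:=\sum_{v}d^{l}_v=\sum_a d^{r}_a$. The graph $\mathrm{RIGC}(\boldsymbol d^l,\mathbf{Com})$ is the multigraph on $[N_n]$ obtained by matching, via a uniformly random bijection, the $h_n$ membership tokens of the individuals ($d^l_v$ tokens for $v$) with the $h_n$ community roles (the vertices of the disjoint union of all $\mathrm{Com}_a$), and adding, for every edge $\{j_1,j_2\}$ of every community graph, one edge between the individuals assigned to $j_1$ and $j_2$. ($\zeta$ is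 the limit of the local clustering coefficient of a uniformly chosen individual; the claim itself only concerns the law of $\zeta$.) **Assumptions.** Let $D_n^l=d^l_{V}$ with $V$ uniform on $[N_n]$, $D_n^r=d^r_{A}$ with $A$ uniform on $[M_n]$, and $\mu^{(n)}_H=|\{a:\mathrm{Com}_a=H\}|/M_n$ for $H\in\mathscr H$. (A) $D_n^l$ converges in distribution to a random variable $D^l$. (B) $\mathbb E[D_n^l]\to\mathbb E[D^l]<\infty$. (C) There is a probability mass function $\mu$ on $\mathscr H$ with $\mu_H^{(n)}\to\mu_H$ for all $H$; consequently $D_n^r$ converges in distribution to $D^r$ with pmf $q_k=\sum_{|H|=k}\mu_H$. (D) $\mathbb E[D_n^r]\to\mathbb E[D^r]<\infty$. **Community degree and triangles.** Choose a community role uniformly at random among all $h_n$ community roles; let $D_n^c$ be its degree within its community graph and $\Lambda_n^c$ the number of triangles of its community graph containing it. Under the assumptions the vector $(D_n^c,\Lambda_n^c)$ converges in distribution; $(D^c,\Lambda^c)$ denotes a random vector with the limiting law. *)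

theory Defs
  imports "HOL-Probability.Probability" "Graph_Theory.Graph_Theory"
begin

text \<open>An undirected simple graph is a \<^locale>\<open>pair_graph\<close>, i.e. a finite, loop-free, symmetric
  digraph without parallel arcs: the edge \<open>{u, v}\<close> is the pair of arcs \<open>(u, v)\<close>, \<open>(v, u)\<close>, so that
  the degree of a vertex is its \<^const>\<open>out_degree\<close>.\<close>

abbreviation graph_size :: "nat pair_pre_digraph \<Rightarrow> nat" where
  "graph_size H \<equiv> card (pverts H)"

definition community_graph :: "nat pair_pre_digraph \<Rightarrow> bool" where
  "community_graph H \<longleftrightarrow>
     pair_graph H \<and> pverts H \<noteq> {} \<and> Digraph_Component.connected (with_proj H) \<and>
     pverts H = {1..graph_size H}"

text \<open>A choice of one representative per isomorphism class. As the vertex type is arbitrary up to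
  isomorphism, it suffices to represent the graphs whose vertex set already is an initial segment.\<close>

definition iso_representatives :: "nat pair_pre_digraph set \<Rightarrow> bool" where
  "iso_representatives \<H> \<longleftrightarrow>
     (\<forall>H\<in>\<H>. community_graph H) \<and>
     (\<forall>G. community_graph G \<longrightarrow> (\<exists>!H. H \<in> \<H> \<and> digraph_iso (with_proj G) (with_proj H)))"

definition triangles_at :: "'a pair_pre_digraph \<Rightarrow> 'a \<Rightarrow> nat" where
  "triangles_at H v =
     card {T. T \<subseteq> pverts H \<and> card T = 3 \<and> v \<in> T \<and>
              (\<forall>x\<in>T. \<forall>y\<in>T. x \<noteq> y \<longrightarrow> (x, y) \<in> parcs H)}"

text \<open>The community roles: the vertices of the disjoint union of the graphs
  \<open>Com 1, \<dots>, Com m\<close>.\<close>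

definition community_roles :: "nat \<Rightarrow> (nat \<Rightarrow> nat pair_pre_digraph) \<Rightarrow> (nat \<times> nat) set" where
  "community_roles m Com = (SIGMA a:{1..m}. pverts (Com a))"

text \<open>The law of \<open>(D\<^sup>c\<^sub>n, \<Lambda>\<^sup>c\<^sub>n)\<close>, for a uniformly chosen community role.\<close>

definition role_law :: "nat \<Rightarrow> (nat \<Rightarrow> nat pair_pre_digraph) \<Rightarrow> (real \<times> real) measure" where
  "role_law m Com =
     distr (measure_pmf (pmf_of_set (community_roles m Com))) borel
       (\<lambda>(a, j). (real (out_degree (with_proj (Com a)) j), real (triangles_at (Com a) j)))"

text \<open>Convergence in distribution. The library's \<^const>\<open>weak_conv_m\<close> covers real-valued random
  variables only; for random vectors we use bounded continuous test functions.\<close>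

definition weak_conv_bdd :: "(nat \<Rightarrow> 'a::topological_space measure) \<Rightarrow> 'a measure \<Rightarrow> bool" where
  "weak_conv_bdd \<nu>s \<nu> \<longleftrightarrow>
     (\<forall>f :: 'a \<Rightarrow> real. continuous_on UNIV f \<and> bounded (range f) \<longrightarrow>
        (\<lambda>n. \<integral>x. f x \<partial>(\<nu>s n)) \<longlonglongrightarrow> (\<integral>x. f x \<partial>\<nu>))"

text \<open>The quotient defining \<open>\<zeta>\<close>, for \<open>k\<close> memberships whose community degrees and triangle counts
  are \<open>d i\<close> and \<open>t i\<close>, \<open>i < k\<close>.\<close>

definition clustering_ratio :: "nat \<Rightarrow> (nat \<Rightarrow> nat) \<Rightarrow> (nat \<Rightarrow> nat) \<Rightarrow> real" where
  "clustering_ratio k d t =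
     (if (\<Sum>i<k. d i) < 2 then 0
      else real (\<Sum>i<k. t i) / real ((\<Sum>i<k. d i) choose 2))"

end

theory Submission
  imports Defs
begin

text \<open>Every triangle through a vertex is spanned by two of its neighbours, so
  \<open>\<Lambda>\<^sup>c\<^sub>n \<le> (D\<^sup>c\<^sub>n choose 2)\<close>, and this passes to the weak limit. By superadditivity of
  \<open>d \<mapsto> d choose 2\<close> the ratio defining \<open>\<zeta>\<close> then lies in \<open>[0, 1]\<close> almost surely. Moreover
  \<open>D\<^sup>l \<ge> 1\<close> almost surely, so \<open>\<zeta>\<close> is positive as soon as the first copy of \<open>\<Lambda>\<^sup>c\<close> is; conversely it
  vanishes almost surely if all the copies of \<open>\<Lambda>\<^sup>c\<close> do.\<close>

section \<open>Triangle counts and binomial inequalities\<close>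

lemma (in pair_graph) triangles_at_le_choose:
  "triangles_at G v \<le> out_degree (with_proj G) v choose 2"
proof -
  define A where "A = {w. (v, w) \<in> parcs G}"
  have arcs: "out_arcs (with_proj G) v = Pair v ` A"
    by (auto simp: A_def out_arcs_def)
  have finA: "finite A"
  proof -
    have "finite (Pair v ` A)"
      using pair_finite_arcs by (rule finite_subset[rotated]) (auto simp: A_def)
    then show ?thesis
      by (rule finite_imageD) (auto simp: inj_on_def)
  qed
  have deg: "out_degree (with_proj G) v = card A"
    unfolding out_degree_def arcs by (rule card_image) (auto simp: inj_on_def)
  have "triangles_at G v \<le> card {S. S \<subseteq> A \<and> card S = 2}"
    unfolding triangles_at_def
  \<comment> \<open>Deleting \<open>v\<close> from a triangle leaves a pair of neighbours of
    \<open>v\<close>, and reinserting \<open>v\<close> recovers the triangle; hence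
    injectivity.\<close>
  proof (rule card_inj_on_le[where f = "\<lambda>T. T - {v}"])
    show "inj_on (\<lambda>T. T - {v}) {T. T \<subseteq> pverts G \<and> card T = 3 \<and> v \<in> T \<and>
        (\<forall>x\<in>T. \<forall>y\<in>T. x \<noteq> y \<longrightarrow> (x, y) \<in> parcs G)}"
      by (rule inj_onI) (metis (no_types, lifting) insert_Diff mem_Collect_eq)
    show "finite {S. S \<subseteq> A \<and> card S = 2}"
      using finA by simp
  qed (auto simp: A_def card_Diff_singleton)
  then show ?thesis
    by (simp add: deg n_subsets[OF finA])
qed

text \<open>The pairs lying inside a single block of a disjoint union are among all pairs of the
  union.\<close>

lemma sum_choose_two_le: "(\<Sum>i\<in>A. d i choose 2) \<le> (\<Sum>i\<in>A. d i) choose 2"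
proof (induction A rule: infinite_finite_induct)
  case (insert x A)
  \<comment> \<open>Raising \<open>a\<close> by one adds \<open>a\<close> on the left and
    \<open>a + b\<close> on the right.\<close>
  have "(a choose 2) + (b choose 2) \<le> (a + b) choose 2" for a b :: nat
    by (induction a) (auto simp: numeral_2_eq_2)
  from order_trans[OF add_left_mono[OF insert.IH] this] insert.hyps show ?case
    by simp
qed auto

section \<open>Deterministic bounds for the clustering ratio\<close>

lemma clustering_ratio_nonneg: "0 \<le> clustering_ratio k d t"
  by (simp add: clustering_ratio_def del: of_nat_sum)

lemma clustering_ratio_le_1:
  assumes "\<And>i. t i \<le> d i choose 2"
  shows "clustering_ratio k d t \<le> 1"
proof -
  have "(\<Sum>i<k. t i) \<le> (\<Sum>i<k. d i) choose 2"
    using sum_mono[of "{..<k}" t "\<lambda>i. d i choose 2"] assms sum_choose_two_le[of d "{..<k}"]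
    by fastforce
  then have "real (\<Sum>i<k. t i) \<le> real ((\<Sum>i<k. d i) choose 2)"
    by (rule of_nat_mono)
  then show ?thesis
    unfolding clustering_ratio_def by (simp add: divide_le_eq_1 del: of_nat_sum)
qed

text \<open>A triangle in summand \<open>j\<close> forces \<open>d j choose 2\<close> to be nonzero,
  so \<open>d j\<close> is at least 2. This rules out the default value 0 of the ratio, and
  \<open>t j\<close> keeps the numerator positive.\<close>

lemma clustering_ratio_pos:
  assumes "\<And>i. t i \<le> d i choose 2" and "j < k" and "t j \<ge> 1"
  shows "clustering_ratio k d t > 0"
proof -
  have "d j \<ge> 2"
    using assms(1)[of j] assms(3) by (cases "d j < 2") (auto simp: binomial_eq_0)
  moreover have "d j \<le> (\<Sum>i<k. d i)" "t j \<le> (\<Sum>i<k. t i)"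
    using assms(2) by (auto intro!: member_le_sum)
  ultimately have "(\<Sum>i<k. d i) \<ge> 2" "(\<Sum>i<k. t i) > 0"
    using assms(3) by linarith+
  then show ?thesis
    unfolding clustering_ratio_def by (simp add: zero_less_binomial del: of_nat_sum)
qed

section \<open>Community roles and their limiting law\<close>

lemma finite_community_roles:
  assumes "\<And>a. a \<in> {1..m} \<Longrightarrow> community_graph (Com a)"
  shows "finite (community_roles m Com)"
proof -
  have "finite (pverts (Com a))" if "a \<in> {1..m}" for a
    using assms[OF that] by (metis community_graph_def finite_atLeastAtMost)
  then show ?thesis
    unfolding community_roles_def by (intro finite_SigmaI) auto
qed

lemma community_roles_nonempty:
  assumes "\<And>a. a \<in> {1..m} \<Longrightarrow> community_graph (Com a)" and "m > 0"
  shows "community_roles m Com \<noteq> {}"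
  using assms(1)[of 1] assms(2) by (fastforce simp: community_roles_def community_graph_def)

text \<open>The inequality holds for every role of every finite model. Weak convergence sees only
  bounded continuous test functions, so the violation of the inequality is measured by such a
  function; its integral is eventually 0, hence 0 in the limit.\<close>

lemma AE_role_law_limit:
  fixes D T :: "'q \<Rightarrow> nat"
  assumes "prob_space Q"
    and meas: "D \<in> measurable Q (count_space UNIV)" "T \<in> measurable Q (count_space UNIV)"
    and M: "filterlim M at_top sequentially"
    and graphs: "\<And>n a. a \<in> {1..M n} \<Longrightarrow> community_graph (Com n a)"
    and lim: "weak_conv_bdd (\<lambda>n. role_law (M n) (Com n))
          (distr Q borel (\<lambda>\<omega>. (real (D \<omega>), real (T \<omega>))))"
  shows "AE \<omega> in Q. T \<omega> \<le> D \<omega> choose 2"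
proof -
  interpret prob_space Q by fact
  \<comment> \<open>The polynomial \<open>x * (x - 1) / 2\<close> extends \<open>d choose 2\<close>
    continuously to the reals. On pairs of naturals the excess is an integer, so truncating it to
    [0, 1] gives exactly the indicator of a violation.\<close>
  define f :: "real \<times> real \<Rightarrow> real"
    where "f p = min 1 (max 0 (snd p - fst p * (fst p - 1) / 2))" for p
  have f_nat: "f (real d, real t) = (if t \<le> d choose 2 then 0 else 1)" for d t :: nat
  proof -
    have "real (d choose 2) = real d * (real d - 1) / 2"
      by (induction d) (auto simp: numeral_2_eq_2 field_simps)
    then have "f (real d, real t) = min 1 (max 0 (real t - real (d choose 2)))"
      by (simp add: f_def)
    then show ?thesis
      by auto
  qed
  have f_cont: "continuous_on UNIV f"
    unfolding f_def by (intro continuous_intros) auto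
  have f_range: "0 \<le> f p" "f p \<le> 1" for p
    by (auto simp: f_def)
  have f_norm: "norm (f p) \<le> 1" for p
    using f_range[of p] by simp
  then have "bounded (range f)"
    by (metis boundedI rangeE)
  with lim f_cont have conv: "(\<lambda>n. \<integral>x. f x \<partial>(role_law (M n) (Com n)))
      \<longlonglongrightarrow> (\<integral>x. f x \<partial>(distr Q borel (\<lambda>\<omega>. (real (D \<omega>), real (T \<omega>)))))"
    unfolding weak_conv_bdd_def by blast
  have [measurable]: "f \<in> borel_measurable borel"
    using f_cont by (rule borel_measurable_continuous_onI)
  note [measurable] = meas
  have pair [measurable]: "(\<lambda>\<omega>. (real (D \<omega>), real (T \<omega>))) \<in> borel_measurable Q"
    by (intro borel_measurable_Pair) measurable
  \<comment> \<open>Only for \<open>M n > 0\<close> is the set of roles nonempty, so that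
    \<open>pmf_of_set\<close> is really the uniform law on it.\<close>
  have "eventually (\<lambda>n. (\<integral>x. f x \<partial>(role_law (M n) (Com n))) = 0) sequentially"
    using eventually_compose_filterlim[OF eventually_gt_at_top[of 0] M]
  proof eventually_elim
    case (elim n)
    let ?R = "community_roles (M n) (Com n)"
    have fin: "finite ?R" "?R \<noteq> {}"
      using finite_community_roles community_roles_nonempty graphs elim by blast+
    have "(\<integral>x. f x \<partial>(role_law (M n) (Com n))) =
        (\<integral>(a, j). f (real (out_degree (with_proj (Com n a)) j), real (triangles_at (Com n a) j))
          \<partial>(measure_pmf (pmf_of_set ?R)))"
      unfolding role_law_def by (subst integral_distr) (auto simp: case_prod_unfold)
    also have "\<dots> = (\<integral>r. 0 \<partial>(measure_pmf (pmf_of_set ?R)))"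
    proof (intro integral_cong_AE AE_pmfI)
      fix r assume "r \<in> set_pmf (pmf_of_set ?R)"
      then have "r \<in> ?R"
        using fin by simp
      then have "pair_graph (Com n (fst r))"
        using graphs by (auto simp: community_roles_def community_graph_def)
      then show "(case r of (a, j) \<Rightarrow>
          f (real (out_degree (with_proj (Com n a)) j), real (triangles_at (Com n a) j))) = 0"
        by (auto simp: case_prod_unfold f_nat dest: pair_graph.triangles_at_le_choose)
    qed auto
    finally show ?case
      by simp
  qed
  then have "(\<lambda>n. \<integral>x. f x \<partial>(role_law (M n) (Com n))) \<longlonglongrightarrow> 0"
    by (rule tendsto_eventually)
  with conv have "(\<integral>x. f x \<partial>(distr Q borel (\<lambda>\<omega>. (real (D \<omega>), real (T \<omega>))))) = 0"
    by (rule LIMSEQ_unique)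
  then have "(\<integral>\<omega>. f (real (D \<omega>), real (T \<omega>)) \<partial>Q) = 0"
    by (subst (asm) integral_distr) auto
  moreover have "integrable Q (\<lambda>\<omega>. f (real (D \<omega>), real (T \<omega>)))"
    by (rule integrable_const_bound[of _ 1]) (auto intro: f_norm simp del: real_norm_def)
  \<comment> \<open>A nonnegative integrable function with integral 0 vanishes almost
    everywhere.\<close>
  ultimately have "AE \<omega> in Q. f (real (D \<omega>), real (T \<omega>)) = 0"
    by (subst (asm) integral_nonneg_eq_0_iff_AE) (auto simp: f_range)
  then show ?thesis
    by eventually_elim (simp add: f_nat split: if_splits)
qed

section \<open>Positivity of the limiting number of memberships\<close>

lemma AE_weak_limit_ge_1:
  fixes X :: "'p \<Rightarrow> nat" and N :: "nat \<Rightarrow> nat" and d :: "nat \<Rightarrow> nat \<Rightarrow> nat"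
  assumes "prob_space P" and X: "X \<in> measurable P (count_space UNIV)"
    and N: "filterlim N at_top sequentially"
    and pos: "\<And>n v. v \<in> {1..N n} \<Longrightarrow> d n v \<ge> 1"
    and lim: "weak_conv_m
          (\<lambda>n. distr (measure_pmf (pmf_of_set {1..N n})) borel (\<lambda>v. real (d n v)))
          (distr P borel (\<lambda>\<omega>. real (X \<omega>)))"
  shows "AE \<omega> in P. X \<omega> \<ge> 1"
proof -
  interpret prob_space P by fact
  note [measurable] = X
  let ?D = "distr P borel (\<lambda>\<omega>. real (X \<omega>))"
  interpret D: real_distribution ?D
    by (intro real_distribution_distr) auto
  \<comment> \<open>The point 1/2 separates 0 from the positive integers and is no atom of an
    integer-valued variable. So the limit cdf is continuous there, and weak convergence yields
    convergence of the cdfs at this point.\<close>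
  have "measure ?D {1/2} = 0"
  proof -
    have "(\<lambda>\<omega>. real (X \<omega>)) -` {1/2} \<inter> space P = {}"
    proof -
      have "real k \<noteq> 1/2" for k
        by (cases k) auto
      then show ?thesis by auto
    qed
    then show ?thesis
      by (simp add: measure_distr)
  qed
  then have "isCont (cdf ?D) (1/2)"
    by (simp add: D.isCont_cdf)
  with lim have conv: "(\<lambda>n. cdf (distr (measure_pmf (pmf_of_set {1..N n})) borel
      (\<lambda>v. real (d n v))) (1/2)) \<longlonglongrightarrow> cdf ?D (1/2)"
    unfolding weak_conv_m_def weak_conv_def by blast
  have "eventually (\<lambda>n. cdf (distr (measure_pmf (pmf_of_set {1..N n})) borel
      (\<lambda>v. real (d n v))) (1/2) = 0) sequentially"
    using eventually_compose_filterlim[OF eventually_gt_at_top[of 0] N]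
  proof eventually_elim
    case (elim n)
    then have "set_pmf (pmf_of_set {1..N n}) = {1..N n}"
      by (intro set_pmf_of_set) auto
    then have "measure (measure_pmf (pmf_of_set {1..N n})) ((\<lambda>v. real (d n v)) -` {..1/2}) = 0"
      using pos[of _ n] by (subst measure_pmf_zero_iff) fastforce
    then show ?case
      by (simp add: cdf_def measure_distr)
  qed
  then have "(\<lambda>n. cdf (distr (measure_pmf (pmf_of_set {1..N n})) borel
      (\<lambda>v. real (d n v))) (1/2)) \<longlonglongrightarrow> 0"
    by (rule tendsto_eventually)
  with conv have "cdf ?D (1/2) = 0"
    by (rule LIMSEQ_unique)
  then have "prob {\<omega> \<in> space P. \<not> X \<omega> \<ge> 1} = 0"
  proof -
    \<comment> \<open>For a natural number, being at most 1/2 means being 0.\<close>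
    have "(\<lambda>\<omega>. real (X \<omega>)) -` {..1/2} \<inter> space P = {\<omega> \<in> space P. \<not> X \<omega> \<ge> 1}"
      by auto
    with \<open>cdf ?D (1/2) = 0\<close> show ?thesis
      by (simp add: cdf_def measure_distr)
  qed
  then show ?thesis
    by (subst AE_iff_measurable[OF _ refl]) (auto simp: emeasure_eq_measure)
qed

section \<open>Positivity of the asymptotic average clustering\<close>

theorem corollary2p11:
  fixes \<H> :: "nat pair_pre_digraph set"
    and N M :: "nat \<Rightarrow> nat"
    and dl :: "nat \<Rightarrow> nat \<Rightarrow> nat"
    and Com :: "nat \<Rightarrow> nat \<Rightarrow> nat pair_pre_digraph"
    and \<mu> :: "nat pair_pre_digraph pmf"
    and P :: "'p measure" and Q :: "'q measure" and S :: "'s measure"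
    and Dl :: "'p \<Rightarrow> nat" and Dcs \<Lambda>cs :: "nat \<Rightarrow> 'p \<Rightarrow> nat"
    and Dc \<Lambda>c :: "'q \<Rightarrow> nat"
    and \<zeta> :: "'s \<Rightarrow> real"
  assumes reps: "iso_representatives \<H>"
    and N_lim: "filterlim N at_top sequentially"
    and M_lim: "filterlim M at_top sequentially"
    and dl_pos: "\<And>n v. v \<in> {1..N n} \<Longrightarrow> dl n v \<ge> 1"
    and Com_in: "\<And>n a. a \<in> {1..M n} \<Longrightarrow> Com n a \<in> \<H>"
    and h_eq: "\<And>n. (\<Sum>v\<in>{1..N n}. dl n v) = (\<Sum>a\<in>{1..M n}. graph_size (Com n a))"
    and prob_spaces: "prob_space P" "prob_space Q" "prob_space S"
    and Dl_rv: "Dl \<in> measurable P (count_space UNIV)"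
    and cond_A: "weak_conv_m
          (\<lambda>n. distr (measure_pmf (pmf_of_set {1..N n})) borel (\<lambda>v. real (dl n v)))
          (distr P borel (\<lambda>\<omega>. real (Dl \<omega>)))"
    and cond_B: "integrable P (\<lambda>\<omega>. real (Dl \<omega>))"
      "(\<lambda>n. measure_pmf.expectation (pmf_of_set {1..N n}) (\<lambda>v. real (dl n v)))
         \<longlonglongrightarrow> prob_space.expectation P (\<lambda>\<omega>. real (Dl \<omega>))"
    and cond_C: "set_pmf \<mu> \<subseteq> \<H>"
      "\<And>H. H \<in> \<H> \<Longrightarrow> (\<lambda>n. real (card {a \<in> {1..M n}. Com n a = H}) / real (M n)) \<longlonglongrightarrow> pmf \<mu> H"
    and cond_D: "integrable (measure_pmf (map_pmf graph_size \<mu>)) (\<lambda>k. real k)"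
      "(\<lambda>n. measure_pmf.expectation (pmf_of_set {1..M n}) (\<lambda>a. real (graph_size (Com n a))))
         \<longlonglongrightarrow> measure_pmf.expectation (map_pmf graph_size \<mu>) (\<lambda>k. real k)"
    and role_rv: "Dc \<in> measurable Q (count_space UNIV)" "\<Lambda>c \<in> measurable Q (count_space UNIV)"
    and role_limit: "weak_conv_bdd (\<lambda>n. role_law (M n) (Com n))
          (distr Q borel (\<lambda>\<omega>. (real (Dc \<omega>), real (\<Lambda>c \<omega>))))"
    and copies_law: "\<And>i. distr P (count_space UNIV) (\<lambda>\<omega>. (Dcs i \<omega>, \<Lambda>cs i \<omega>)) =
          distr Q (count_space UNIV) (\<lambda>\<omega>. (Dc \<omega>, \<Lambda>c \<omega>))"
    and copies_indep: "prob_space.indep_vars P (\<lambda>i. count_space UNIV)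
          (\<lambda>i \<omega>. (Dcs i \<omega>, \<Lambda>cs i \<omega>)) UNIV"
    and copies_indep_Dl: "prob_space.indep_set P
          (sets (vimage_algebra (space P) Dl (count_space UNIV)))
          (sets (vimage_algebra (space P) (\<lambda>\<omega> i. (Dcs i \<omega>, \<Lambda>cs i \<omega>))
             (PiM UNIV (\<lambda>i::nat. count_space (UNIV :: (nat \<times> nat) set)))))"
    and zeta_rv: "\<zeta> \<in> borel_measurable S"
    and zeta_law: "distr S borel \<zeta> =
          distr P borel (\<lambda>\<omega>. clustering_ratio (Dl \<omega>) (\<lambda>i. Dcs i \<omega>) (\<lambda>i. \<Lambda>cs i \<omega>))"
  shows "prob_space.expectation S \<zeta> > 0 \<longleftrightarrow> prob_space.prob Q {\<omega> \<in> space Q. \<Lambda>c \<omega> \<ge> 1} > 0"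
proof -
  interpret P: prob_space P by fact
  interpret Q: prob_space Q by fact
  let ?R = "\<lambda>\<omega>. clustering_ratio (Dl \<omega>) (\<lambda>i. Dcs i \<omega>) (\<lambda>i. \<Lambda>cs i \<omega>)"
  have pair_P: "(\<lambda>\<omega>. (Dcs i \<omega>, \<Lambda>cs i \<omega>)) \<in> measurable P (count_space UNIV)" for i
    using copies_indep by (simp add: P.indep_vars_def)
  have [measurable]: "Dcs i \<in> measurable P (count_space UNIV)"
      "\<Lambda>cs i \<in> measurable P (count_space UNIV)" for i
    using measurable_compose[OF pair_P[of i], of fst "count_space UNIV"]
      measurable_compose[OF pair_P[of i], of snd "count_space UNIV"] by simp_all
  note [measurable] = Dl_rv role_rv
  have pair_Q: "(\<lambda>\<omega>. (Dc \<omega>, \<Lambda>c \<omega>)) \<in> measurable Q (count_space UNIV)"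
    by measurable
  have R_meas [measurable]: "?R \<in> borel_measurable P"
  \<comment> \<open>The number of summands is random but takes countably many values, so it may be
    fixed.\<close>
  proof (rule measurable_compose_countable[OF _ Dl_rv])
    fix k
    show "(\<lambda>\<omega>. clustering_ratio k (\<lambda>i. Dcs i \<omega>) (\<lambda>i. \<Lambda>cs i \<omega>)) \<in> borel_measurable P"
      unfolding clustering_ratio_def by measurable
  qed
  \<comment> \<open>Almost sure properties of a pair depend only on its joint law, which each copy
    shares with the limit vector.\<close>
  have transfer: "(AE \<omega> in P. p (Dcs i \<omega>) (\<Lambda>cs i \<omega>)) \<longleftrightarrow> (AE \<omega> in Q. p (Dc \<omega>) (\<Lambda>c \<omega>))" for p i
  proof -
    have "(AE \<omega> in P. p (Dcs i \<omega>) (\<Lambda>cs i \<omega>)) \<longleftrightarrow>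
        (AE x in distr P (count_space UNIV) (\<lambda>\<omega>. (Dcs i \<omega>, \<Lambda>cs i \<omega>)). case_prod p x)"
      by (subst AE_distr_iff[OF pair_P]) auto
    also have "\<dots> \<longleftrightarrow> (AE x in distr Q (count_space UNIV) (\<lambda>\<omega>. (Dc \<omega>, \<Lambda>c \<omega>)). case_prod p x)"
      by (simp only: copies_law)
    also have "\<dots> \<longleftrightarrow> (AE \<omega> in Q. p (Dc \<omega>) (\<Lambda>c \<omega>))"
      by (subst AE_distr_iff[OF pair_Q]) auto
    finally show ?thesis .
  qed
  have "AE \<omega> in Q. \<Lambda>c \<omega> \<le> Dc \<omega> choose 2"
    using prob_spaces(2) role_rv M_lim _ role_limit
  proof (rule AE_role_law_limit)
    show "community_graph (Com n a)" if "a \<in> {1..M n}" for n a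
      using Com_in[OF that] reps by (simp add: iso_representatives_def)
  qed
  then have bound: "AE \<omega> in P. \<forall>i. \<Lambda>cs i \<omega> \<le> Dcs i \<omega> choose 2"
    using transfer[of "\<lambda>d t. t \<le> d choose 2"] by (simp add: AE_all_countable)
  have Dl_pos: "AE \<omega> in P. Dl \<omega> \<ge> 1"
    using prob_spaces(1) Dl_rv N_lim dl_pos cond_A by (rule AE_weak_limit_ge_1)
  \<comment> \<open>Integrability ensures that a zero expectation is a true integral and not the
    default value for non-integrable functions.\<close>
  have R_int: "integrable P ?R"
  proof (rule P.integrable_const_bound[of _ 1])
    show "AE \<omega> in P. norm (?R \<omega>) \<le> 1"
      using bound by eventually_elim (simp add: clustering_ratio_nonneg clustering_ratio_le_1)
  qed (rule R_meas)
  have "prob_space.expectation S \<zeta> = (\<integral>x. x \<partial>(distr S borel \<zeta>))"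
    using zeta_rv by (simp add: integral_distr)
  also have "\<dots> = P.expectation ?R"
    unfolding zeta_law by (simp add: integral_distr)
  finally have expect: "prob_space.expectation S \<zeta> = P.expectation ?R" .
  \<comment> \<open>The equivalence is proved in negated form, since vanishing of a nonnegative
    expectation is a statement about null sets.\<close>
  have "P.expectation ?R = 0 \<longleftrightarrow> (AE \<omega> in P. ?R \<omega> = 0)"
    using R_int by (intro integral_nonneg_eq_0_iff_AE) (auto simp: clustering_ratio_nonneg)
  also have "\<dots> \<longleftrightarrow> (AE \<omega> in P. \<forall>i. \<Lambda>cs i \<omega> = 0)"
  proof
    assume R0: "AE \<omega> in P. ?R \<omega> = 0"
    \<comment> \<open>Copy 0 always enters the sums because \<open>Dl\<close> is at least 1 almost
      surely; a triangle there would make the ratio positive.\<close>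
    have "AE \<omega> in P. \<Lambda>cs 0 \<omega> = 0"
      using R0 bound Dl_pos
    proof eventually_elim
      case (elim \<omega>)
      then show ?case
        using clustering_ratio_pos[of "\<lambda>i. \<Lambda>cs i \<omega>" "\<lambda>i. Dcs i \<omega>" 0 "Dl \<omega>"] by force
    qed
    \<comment> \<open>Vanishing passes from copy 0 to the common law on \<open>Q\<close> and from
      there to every copy.\<close>
    then have "AE \<omega> in P. \<Lambda>cs i \<omega> = 0" for i
      using transfer[of "\<lambda>d t. t = 0"] by simp
    then show "AE \<omega> in P. \<forall>i. \<Lambda>cs i \<omega> = 0"
      by (simp add: AE_all_countable)
  next
    assume "AE \<omega> in P. \<forall>i. \<Lambda>cs i \<omega> = 0"
    then show "AE \<omega> in P. ?R \<omega> = 0"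
      by eventually_elim (simp add: clustering_ratio_def)
  qed
  also have "\<dots> \<longleftrightarrow> (AE \<omega> in Q. \<Lambda>c \<omega> = 0)"
    using transfer[of "\<lambda>d t. t = 0"] by (simp add: AE_all_countable)
  also have "\<dots> \<longleftrightarrow> Q.prob {\<omega> \<in> space Q. \<Lambda>c \<omega> \<ge> 1} = 0"
    by (subst AE_iff_measurable[OF _ refl]) (auto simp: Q.emeasure_eq_measure Suc_le_eq)
  finally have "P.expectation ?R = 0 \<longleftrightarrow> Q.prob {\<omega> \<in> space Q. \<Lambda>c \<omega> \<ge> 1} = 0" .
  \<comment> \<open>With both quantities nonnegative, being nonzero is the same as being
    positive.\<close>
  moreover have "P.expectation ?R \<ge> 0"
    by (simp add: clustering_ratio_nonneg)
  ultimately show ?thesis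
    unfolding expect by (simp add: zero_less_measure_iff order_less_le)
qed

end
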